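(* Let $C_1$ and $C_2$ be clones on $\{0,1\}$ such that $C_1 \subseteq K_1$ and $C_2 \subseteq K_2$ for some $K_1 \in \{U^2, W^2\}$ and some $K_2 \in \{U^\infty, W^\infty\}$. Then there are uncountably many $(C_1,C_2)$-clonoids of Boolean functions.
   Context: A Boolean function is a map $f \colon \{0,1\}^n \to \{0,1\}$ for some integer $n \geq 1$ (its arity). If $f$ is $n$-ary and $g_1,\dots,g_n$ are $m$-ary, then $f(g_1,\dots,g_n)$ is the $m$-ary function $\mathbf{a} \mapsto f(g_1(\mathbf{a}),\dots,g_n(\mathbf{a}))$. For sets $F, G$ of Boolean functions, $FG$ is the set of all composites $f(g_1,\dots,g_n)$ with $f \in F$ of some arity $n$ and $g_1,\dots,g_n \in G$ all of a common arity. A clone on $\{0,1\}$ is a set $C$ of Boolean functions containing all projections and satisfying $CC \subseteq C$. For clones $C_1,C_2$ on $\{0,1\}$, a (possibly empty) set $K$ of Boolean functions is a $(C_1,C_2)$-clonoid if $KC_1 \subseteq K$ and $C_2K \subseteq K$. For $k \in \{2,3,\dots\}\cup\{\infty\}$, $U^k$ is the set (clone) of all Boolean functions $f$ such that $\bigwedge T \neq \mathbf{0}=(0,\dots,0)$ for every $T \subseteq f^{-1}(1)$ with $|T| \leq k$, and $W^k$ is the set (clone) of all Boolean functions $f$ such that $\bigvee F \neq \mathbf{1}=(1,\dots,1)$ for every $F \subseteq f^{-1}(0)$ with $|F| \leq k$ (meets and joins are componentwise, $\bigwedge\emptyset=\mathbf{1}$, $\bigvee\emptyset=\mathbf{0}$;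 for $k=\infty$ there is no restriction on the cardinality). *)

theory Defs
  imports
    "HOL-Library.Countable_Set"
    "HOL-Library.Extended_Nat"
    "HOL-Library.FuncSet"
begin

definition tuples :: "nat \<Rightarrow> bool list set"
  where "tuples n = {a. length a = n}"

text \<open>
  A Boolean function is a pair of its arity and its map. The arity is recorded explicitly, and the
  map is required to be extensional (\<open>undefined\<close> on lists of any other length), so that equality of
  pairs is exactly equality of Boolean functions; without extensionality a single Boolean function
  would have uncountably many representatives.
\<close>

type_synonym boolfun = "nat \<times> (bool list \<Rightarrow> bool)"

definition boolfuns :: "boolfun set"
  where "boolfuns = {(n, f). 1 \<le> n \<and> f \<in> tuples n \<rightarrow>\<^sub>E (UNIV :: bool set)}"

definition proj :: "nat \<Rightarrow> nat \<Rightarrow> boolfun"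
  where "proj n i = (n, restrict (\<lambda>a. a ! i) (tuples n))"

text \<open>
  The common arity \<open>m\<close> of the inner functions is an argument of the composition; the outer
  function is applied only to lists whose length is its own arity.
\<close>

definition bcomp :: "nat \<Rightarrow> boolfun \<Rightarrow> boolfun list \<Rightarrow> boolfun"
  where "bcomp m f gs = (m, restrict (\<lambda>a. snd f (map (\<lambda>g. snd g a) gs)) (tuples m))"

definition set_comp :: "boolfun set \<Rightarrow> boolfun set \<Rightarrow> boolfun set"
  where "set_comp F G =
    {bcomp m f gs | m f gs. f \<in> F \<and> length gs = fst f \<and> (\<forall>g\<in>set gs. g \<in> G \<and> fst g = m)}"

definition clone :: "boolfun set \<Rightarrow> bool"
  where "clone C \<longleftrightarrow>
    C \<subseteq> boolfuns \<and> (\<forall>n i. i < n \<longrightarrow> proj n i \<in> C) \<and> set_comp C C \<subseteq> C"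

definition clonoid :: "boolfun set \<Rightarrow> boolfun set \<Rightarrow> boolfun set \<Rightarrow> bool"
  where "clonoid C1 C2 K \<longleftrightarrow>
    K \<subseteq> boolfuns \<and> set_comp K C1 \<subseteq> K \<and> set_comp C2 K \<subseteq> K"

text \<open>Componentwise; the arity is an argument so that the empty meet and join are defined.\<close>

definition meet :: "nat \<Rightarrow> bool list set \<Rightarrow> bool list"
  where "meet n T = map (\<lambda>i. \<forall>a\<in>T. a ! i) [0..<n]"

definition join :: "nat \<Rightarrow> bool list set \<Rightarrow> bool list"
  where "join n T = map (\<lambda>i. \<exists>a\<in>T. a ! i) [0..<n]"

text \<open>
  All sets \<open>T\<close> and \<open>F\<close> below are finite, being sets of tuples of a fixed length, so \<open>card\<close> is their
  cardinality, and for \<open>k = \<infinity>\<close> the bound is no restriction.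
\<close>

definition U :: "enat \<Rightarrow> boolfun set"
  where "U k = {(n, f) \<in> boolfuns.
    \<forall>T. T \<subseteq> {a \<in> tuples n. f a} \<and> enat (card T) \<le> k \<longrightarrow> meet n T \<noteq> replicate n False}"

definition W :: "enat \<Rightarrow> boolfun set"
  where "W k = {(n, f) \<in> boolfuns.
    \<forall>F. F \<subseteq> {a \<in> tuples n. \<not> f a} \<and> enat (card F) \<le> k \<longrightarrow> join n F \<noteq> replicate n True}"

end

(* Call two tuples adjacent if they have no common coordinate 1. A tuple of inner functions from U^2
   preserves adjacency, so precomposing f with it gives a function whose graph of true points
   maps homomorphically to that of f; and a function in U^infinity lies below a projection, so
   composing it with elements of K only shrinks the set of true points of one of them. Hence, for every
   real r, the functions whose graph of true points has fractional chromatic number at most r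
   form a clonoid. The threshold functions "weight at least k" of arity n >= 2 k have Kneser-like graphs
   of fractional chromatic number n/k (the lower bound is Katona's circle argument for the Erdos-Ko-Rado
   theorem), so distinct r >= 2 give distinct clonoids. The parameters p and q below
   (True for U, False for W) treat the four cases, which are dual to each other, uniformly. *)

theory Submission
  imports Defs "HOL-Analysis.Continuum_Not_Denumerable"
begin

section \<open>Adjacency of tuples and the clones \<open>U\<close> and \<open>W\<close>\<close>

text \<open>Adjacency is the negation. A tuple without an entry \<open>p\<close> is adjacent to
  itself, so a graph containing it has no colouring with \<open>0 < b\<close>.\<close>

definition common :: "bool \<Rightarrow> bool list \<Rightarrow> bool list \<Rightarrow> bool"
  where "common p x y \<longleftrightarrow> (\<exists>i<length x. x ! i = p \<and> y ! i = p)"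

lemma U_2_common:
  assumes "g \<in> U 2" "length x = fst g" "length y = fst g" "snd g x" "snd g y"
  shows "common True x y"
proof -
  have "card {x, y} \<le> 2"
    by (simp add: card_insert_if)
  then have "enat (card {x, y}) \<le> 2"
    by (metis enat_ord_simps(1) numeral_eq_enat)
  moreover have "{x, y} \<subseteq> {a \<in> tuples (fst g). snd g a}"
    using assms by (auto simp: tuples_def)
  ultimately have "meet (fst g) {x, y} \<noteq> replicate (fst g) False"
    using assms(1) by (auto simp: U_def)
  then show ?thesis
    using assms(2) by (auto simp: meet_def common_def list_eq_iff_nth_eq)
qed

lemma W_2_common:
  assumes "g \<in> W 2" "length x = fst g" "length y = fst g" "\<not> snd g x" "\<not> snd g y"
  shows "common False x y"
proof -
  have "card {x, y} \<le> 2"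
    by (simp add: card_insert_if)
  then have "enat (card {x, y}) \<le> 2"
    by (metis enat_ord_simps(1) numeral_eq_enat)
  moreover have "{x, y} \<subseteq> {a \<in> tuples (fst g). \<not> snd g a}"
    using assms by (auto simp: tuples_def)
  ultimately have "join (fst g) {x, y} \<noteq> replicate (fst g) True"
    using assms(1) by (auto simp: W_def)
  then show ?thesis
    using assms(2) by (auto simp: join_def common_def list_eq_iff_nth_eq)
qed

text \<open>With no bound on the cardinality, \<open>T\<close> can be the set of all true points;
  any coordinate where its meet is 1 serves as \<open>i\<close>.\<close>

lemma U_infinity_le_proj:
  assumes "h \<in> U \<infinity>"
  shows "\<exists>i<fst h. \<forall>x. length x = fst h \<longrightarrow> snd h x \<longrightarrow> x ! i"
proof -
  have "meet (fst h) {a \<in> tuples (fst h). snd h a} \<noteq> replicate (fst h) False"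
    using assms by (auto simp: U_def)
  then show ?thesis
    by (auto simp: meet_def tuples_def list_eq_iff_nth_eq)
qed

lemma W_infinity_ge_proj:
  assumes "h \<in> W \<infinity>"
  shows "\<exists>i<fst h. \<forall>x. length x = fst h \<longrightarrow> \<not> snd h x \<longrightarrow> \<not> x ! i"
proof -
  have "join (fst h) {a \<in> tuples (fst h). \<not> snd h a} \<noteq> replicate (fst h) True"
    using assms by (auto simp: W_def)
  then show ?thesis
    by (auto simp: join_def tuples_def list_eq_iff_nth_eq)
qed

section \<open>Clonoids from bounds on the fractional chromatic number\<close>

text \<open>\<open>\<phi>\<close> is a \<open>b\<close>-fold colouring with \<open>a\<close> colours of the graph on the \<open>q\<close>-points of \<open>f\<close>.\<close>

definition multicolouring ::
    "bool \<Rightarrow> bool \<Rightarrow> boolfun \<Rightarrow> nat \<Rightarrow> nat \<Rightarrow> (bool list \<Rightarrow> nat set) \<Rightarrow> bool"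
  where "multicolouring p q f a b \<phi> \<longleftrightarrow>
    (\<forall>x. length x = fst f \<longrightarrow> snd f x = q \<longrightarrow> \<phi> x \<subseteq> {..<a} \<and> b \<le> card (\<phi> x)) \<and>
    (\<forall>x y. length x = fst f \<longrightarrow> length y = fst f \<longrightarrow> snd f x = q \<longrightarrow> snd f y = q \<longrightarrow>
      \<not> common p x y \<longrightarrow> \<phi> x \<inter> \<phi> y = {})"

text \<open>On a finite graph without loops the infimum of \<open>a / b\<close> over such colourings
  is attained, so this is exactly the bound \<open>r\<close> on the fractional chromatic
  number.\<close>

definition fractional_clonoid :: "bool \<Rightarrow> bool \<Rightarrow> real \<Rightarrow> boolfun set"
  where "fractional_clonoid p q r =
    {f \<in> boolfuns. \<exists>a b \<phi>. 0 < b \<and> real a \<le> r * real b \<and> multicolouring p q f a b \<phi>}"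

lemma bcomp_in_boolfuns: "1 \<le> m \<Longrightarrow> bcomp m f gs \<in> boolfuns"
  by (auto simp: bcomp_def boolfuns_def)

text \<open>Colourings pull back along graph homomorphisms. The tuple \<open>gs\<close> acts as one:
  if two images share an entry \<open>p\<close> at position \<open>i\<close>, both arguments are
  \<open>p\<close>-points of \<open>gs ! i\<close> and so share an entry \<open>p\<close>
  themselves.\<close>

lemma multicolouring_inner_comp:
  assumes f: "multicolouring p q f a b \<phi>" and len: "length gs = fst f"
    and gs: "\<And>g x y. g \<in> set gs \<Longrightarrow> length x = m \<Longrightarrow> length y = m \<Longrightarrow>
      snd g x = p \<Longrightarrow> snd g y = p \<Longrightarrow> common p x y"
  shows "multicolouring p q (bcomp m f gs) a b (\<lambda>x. \<phi> (map (\<lambda>g. snd g x) gs))"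
proof -
  have "common p x y"
    if xy: "common p (map (\<lambda>g. snd g x) gs) (map (\<lambda>g. snd g y) gs)" "length x = m" "length y = m" for x y
  proof -
    obtain i where "i < length gs" "snd (gs ! i) x = p" "snd (gs ! i) y = p"
      using xy(1) by (auto simp: common_def)
    then show ?thesis
      using gs[OF nth_mem] xy(2,3) by blast
  qed
  then have "\<phi> (map (\<lambda>g. snd g x) gs) \<inter> \<phi> (map (\<lambda>g. snd g y) gs) = {}"
    if "snd f (map (\<lambda>g. snd g x) gs) = q" "snd f (map (\<lambda>g. snd g y) gs) = q"
      "\<not> common p x y" "length x = m" "length y = m" for x y
    using that f len unfolding multicolouring_def by (metis length_map)
  moreover have "\<phi> (map (\<lambda>g. snd g x) gs) \<subseteq> {..<a} \<and> b \<le> card (\<phi> (map (\<lambda>g. snd g x) gs))"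
    if "snd f (map (\<lambda>g. snd g x) gs) = q" for x
    using that f len unfolding multicolouring_def by (metis length_map)
  ultimately show ?thesis
    unfolding multicolouring_def by (simp add: bcomp_def tuples_def)
qed

text \<open>Every \<open>q\<close>-point of the composite is a \<open>q\<close>-point of
  \<open>gs ! i\<close>, so the same colouring is merely restricted.\<close>

lemma multicolouring_outer_comp:
  assumes "multicolouring p q (gs ! i) a b \<phi>" "i < length gs" "fst (gs ! i) = m"
    and "length gs = fst h" "\<And>x. length x = fst h \<Longrightarrow> snd h x = q \<Longrightarrow> x ! i = q"
  shows "multicolouring p q (bcomp m h gs) a b \<phi>"
proof -
  have "snd (gs ! i) x = q" if "snd h (map (\<lambda>g. snd g x) gs) = q" for x
    using assms(5)[OF _ that] assms(2,4) by simp
  then show ?thesis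
    using assms(1,3) by (auto simp: multicolouring_def bcomp_def tuples_def)
qed

lemma clonoid_fractional_clonoid:
  assumes C1: "C1 \<subseteq> boolfuns"
    "\<And>g x y. g \<in> C1 \<Longrightarrow> length x = fst g \<Longrightarrow> length y = fst g \<Longrightarrow>
      snd g x = p \<Longrightarrow> snd g y = p \<Longrightarrow> common p x y"
    and C2: "\<And>h. h \<in> C2 \<Longrightarrow> \<exists>i<fst h. \<forall>x. length x = fst h \<longrightarrow> snd h x = q \<longrightarrow> x ! i = q"
  shows "clonoid C1 C2 (fractional_clonoid p q r)"
  unfolding clonoid_def
proof (intro conjI)
  show "fractional_clonoid p q r \<subseteq> boolfuns"
    by (auto simp: fractional_clonoid_def)
  show "set_comp (fractional_clonoid p q r) C1 \<subseteq> fractional_clonoid p q r"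
  proof
    fix c assume "c \<in> set_comp (fractional_clonoid p q r) C1"
    then obtain m f gs where c: "c = bcomp m f gs" "f \<in> fractional_clonoid p q r"
        "length gs = fst f" "\<And>g. g \<in> set gs \<Longrightarrow> g \<in> C1 \<and> fst g = m"
      unfolding set_comp_def by blast
    then obtain a b \<phi> where ab: "0 < b" "real a \<le> r * real b" "multicolouring p q f a b \<phi>"
      by (auto simp: fractional_clonoid_def)
    \<comment> \<open>The arity of \<open>f\<close> is positive, so there is an inner function, and
      its arity \<open>m\<close> is positive; hence the composite lies in
      \<open>boolfuns\<close>.\<close>
    have "0 < length gs"
      using c(2,3) by (auto simp: fractional_clonoid_def boolfuns_def)
    then have "1 \<le> m"
      using c(4)[of "gs ! 0"] C1(1) by (auto simp: boolfuns_def)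
    moreover have "multicolouring p q c a b (\<lambda>x. \<phi> (map (\<lambda>g. snd g x) gs))"
      unfolding c(1)
    proof (rule multicolouring_inner_comp[OF ab(3) c(3)])
      show "common p x y" if "g \<in> set gs" "length x = m" "length y = m" "snd g x = p" "snd g y = p"
        for g x y
        using C1(2)[of g x y] c(4)[of g] that by simp
    qed
    ultimately show "c \<in> fractional_clonoid p q r"
      using ab c(1) bcomp_in_boolfuns unfolding fractional_clonoid_def by blast
  qed
  show "set_comp C2 (fractional_clonoid p q r) \<subseteq> fractional_clonoid p q r"
  proof
    fix c assume "c \<in> set_comp C2 (fractional_clonoid p q r)"
    then obtain m h gs where c: "c = bcomp m h gs" "h \<in> C2" "length gs = fst h"
        "\<And>g. g \<in> set gs \<Longrightarrow> g \<in> fractional_clonoid p q r \<and> fst g = m"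
      unfolding set_comp_def by blast
    obtain i where i: "i < fst h" "\<And>x. length x = fst h \<Longrightarrow> snd h x = q \<Longrightarrow> x ! i = q"
      using C2[OF c(2)] by blast
    have gi: "gs ! i \<in> fractional_clonoid p q r" "fst (gs ! i) = m"
      using c(3,4) i(1) by auto
    then obtain a b \<phi> where ab: "0 < b" "real a \<le> r * real b" "multicolouring p q (gs ! i) a b \<phi>"
      by (auto simp: fractional_clonoid_def)
    have "1 \<le> m"
      using gi by (auto simp: fractional_clonoid_def boolfuns_def)
    moreover have "multicolouring p q c a b \<phi>"
      unfolding c(1) using i c(3) by (intro multicolouring_outer_comp[OF ab(3) _ gi(2)]) simp_all
    ultimately show "c \<in> fractional_clonoid p q r"
      using ab c(1) bcomp_in_boolfuns unfolding fractional_clonoid_def by blast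
  qed
qed

section \<open>Katona's circle argument\<close>

definition arc :: "nat \<Rightarrow> nat \<Rightarrow> nat \<Rightarrow> nat set"
  where "arc n k i = (\<lambda>j. (i + j) mod n) ` {..<k}"

lemma card_arc:
  assumes "k \<le> n"
  shows "card (arc n k i) = k"
proof -
  have "inj_on (\<lambda>j. (i + j) mod n) {..<k}"
  proof (rule linorder_inj_onI)
    fix x y assume "x < y" "x \<in> {..<k}" "y \<in> {..<k}"
    then have *: "y - x < n" "0 < y - x"
      using assms by auto
    show "(i + x) mod n \<noteq> (i + y) mod n"
    proof
      assume "(i + x) mod n = (i + y) mod n"
      then have "n dvd (i + y) - (i + x)"
        using \<open>x < y\<close> by (metis mod_eq_dvd_iff_nat add_le_cancel_left less_imp_le)
      then show False
        using * by (simp add: nat_dvd_not_less)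
    qed
  qed auto
  then show ?thesis
    by (simp add: arc_def card_image)
qed

text \<open>A common point \<open>i + s = j + t\<close> modulo \<open>n\<close> yields the offset
  \<open>s - t\<close>, strictly between \<open>-k\<close> and \<open>k\<close>; the disjuncts are
  its residues for \<open>t \<le> s\<close> and for \<open>s < t\<close>.\<close>

lemma arcs_meet_offset:
  assumes "arc n k i \<inter> arc n k j \<noteq> {}" "k \<le> n"
  shows "(int j - int i) mod int n < int k \<or> int n - int k < (int j - int i) mod int n"
proof -
  from assms obtain s t where st: "s < k" "t < k" "(i + s) mod n = (j + t) mod n"
    by (auto simp: arc_def)
  then have "(int i + int s) mod int n = (int j + int t) mod int n"
    by (metis of_nat_add zmod_int)
  then have "int n dvd (int i + int s) - (int j + int t)"
    by (simp add: mod_eq_dvd_iff)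
  then have "int n dvd (int s - int t) - (int j - int i)"
    by (simp add: algebra_simps)
  then have eq: "(int j - int i) mod int n = (int s - int t) mod int n"
    by (simp add: mod_eq_dvd_iff[symmetric])
  show ?thesis
  proof (cases "t \<le> s")
    case True
    then have "(int s - int t) mod int n = int s - int t"
      using st assms(2) by (intro mod_pos_pos_trivial) auto
    then show ?thesis using eq st by simp
  next
    case False
    then have "(int s - int t + int n) mod int n = int s - int t + int n"
      using st assms(2) by (intro mod_pos_pos_trivial) auto
    then show ?thesis using eq st by simp
  qed
qed

text \<open>Relative to a fixed member, all starting offsets lie strictly within \<open>k\<close> of
  0 on the circle. The nonzero ones pair off as \<open>d\<close> and \<open>d - k\<close>; the two
  arcs of a pair are disjoint since \<open>2 * k \<le> n\<close>, so each of the
  \<open>k - 1\<close> pairs contributes at most one member.\<close>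

lemma katona_circle:
  assumes k: "0 < k" "2 * k \<le> n" and I: "I \<subseteq> {..<n}"
    and meets: "\<And>i j. i \<in> I \<Longrightarrow> j \<in> I \<Longrightarrow> arc n k i \<inter> arc n k j \<noteq> {}"
  shows "card I \<le> k"
proof (cases "I = {}")
  case False
  then obtain i0 where i0: "i0 \<in> I" by blast
  define d where "d i = (int i - int i0) mod int n" for i
  have d_range: "0 \<le> d i" "d i < int n" for i
    using k by (auto simp: d_def)
  have d_diff: "(int j - int i) mod int n = (d j - d i) mod int n" for i j
    unfolding d_def by (simp add: mod_diff_eq)
  have d_cases: "d i < int k \<or> int n - int k < d i" if "i \<in> I" for i
    unfolding d_def using arcs_meet_offset[OF meets[OF i0 that]] k by simp
  have d_inj: "i = j" if "i \<in> I" "j \<in> I" "d i = d j" for i j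
  proof -
    have "(int j - int i) mod int n = 0"
      using d_diff[of j i] that(3) by simp
    then have "int j mod int n = int i mod int n"
      by (simp add: mod_eq_dvd_iff mod_eq_0_iff_dvd)
    moreover have "i < n" "j < n" using that I by auto
    ultimately show ?thesis by simp
  qed
  \<comment> \<open>The offset \<open>n - k\<close> just misses both ranges of
    \<open>arcs_meet_offset\<close>: it is at least \<open>k\<close> and not greater than
    \<open>n - k\<close>.\<close>
  have no_pair: False if "i \<in> I" "j \<in> I" "d j = d i + (int n - int k)" for i j
  proof -
    have "(int j - int i) mod int n = (int n - int k) mod int n"
      using d_diff[of j i] that(3) by simp
    also have "\<dots> = int n - int k"
      using k by (intro mod_pos_pos_trivial) auto
    finally show False
      using arcs_meet_offset[OF meets[OF that(1,2)]] k by simp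
  qed
  \<comment> \<open>Offsets \<open>d\<close> and \<open>d + n - k\<close> belong to disjoint arcs, so identifying them loses nothing.\<close>
  define e where "e i = (if d i < int k then d i else d i - (int n - int k))" for i
  have "inj_on e I"
  proof (rule inj_onI)
    fix i j assume ij: "i \<in> I" "j \<in> I" "e i = e j"
    show "i = j"
    proof (cases "(d i < int k) = (d j < int k)")
      case True
      then show ?thesis using ij d_inj by (auto simp: e_def split: if_splits)
    next
      case False
      then have "d j = d i + (int n - int k) \<or> d i = d j + (int n - int k)"
        using ij(3) by (auto simp: e_def split: if_splits)
      then show ?thesis using no_pair ij by blast
    qed
  qed
  moreover have "e ` I \<subseteq> {0..<int k}"
    using d_range d_cases by (fastforce simp: e_def)
  ultimately have "card I \<le> card {0..<int k}"
    by (intro card_inj_on_le) auto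
  then show ?thesis by simp
qed simp

section \<open>Threshold functions separate the clonoids\<close>

text \<open>Comparing with \<open>q\<close> makes the \<open>q\<close>-points the tuples with at
  least \<open>k\<close> entries \<open>p\<close>, whatever \<open>p\<close> and \<open>q\<close>
  are.\<close>

definition threshold :: "bool \<Rightarrow> bool \<Rightarrow> nat \<Rightarrow> nat \<Rightarrow> boolfun"
  where "threshold p q n k =
    (n, restrict (\<lambda>x. (k \<le> card {i. i < n \<and> x ! i = p}) = q) (tuples n))"

lemma threshold_in_fractional_clonoid:
  assumes "0 < k" "0 < n" "real n \<le> r * real k"
  shows "threshold p q n k \<in> fractional_clonoid p q r"
proof -
  \<comment> \<open>The colours of a tuple are its \<open>p\<close>-positions. There may be more
    than \<open>k\<close> of them, which is why \<open>multicolouring\<close> bounds the number of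
    colours only from below.\<close>
  have "multicolouring p q (threshold p q n k) n k (\<lambda>x. {i. i < n \<and> x ! i = p})"
    by (auto simp: multicolouring_def threshold_def tuples_def common_def)
  moreover have "threshold p q n k \<in> boolfuns"
    using assms by (auto simp: boolfuns_def threshold_def)
  ultimately show ?thesis
    using assms unfolding fractional_clonoid_def by blast
qed

text \<open>Double counting of the pairs of an arc \<open>i\<close> and a colour \<open>c\<close> of
  its indicator tuple \<open>v i\<close>: each arc has at least \<open>b\<close> colours, and the
  arcs with a given colour meet pairwise, so there are at most \<open>k\<close> of them.\<close>

lemma multicolouring_threshold_ratio:
  assumes k: "0 < k" "2 * k \<le> n" and col: "multicolouring p q (threshold p q n k) a b \<phi>"
  shows "n * b \<le> a * k"
proof -
  define v where "v i = map (\<lambda>l. (l \<in> arc n k i) = p) [0..<n]" for i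
  have arc_sub: "arc n k i \<subseteq> {..<n}" for i
    using k by (auto simp: arc_def)
  have "{l. l < n \<and> v i ! l = p} = arc n k i" for i
    using arc_sub[of i] by (auto simp: v_def)
  then have true: "snd (threshold p q n k) (v i) = q" and len: "length (v i) = n" for i
    using k by (auto simp: threshold_def tuples_def card_arc) (auto simp: v_def)
  have ar: "fst (threshold p q n k) = n"
    by (simp add: threshold_def)
  have \<phi>: "\<phi> (v i) \<subseteq> {..<a}" "b \<le> card (\<phi> (v i))" for i
    using col true len unfolding multicolouring_def ar by blast+
  have meets: "arc n k i \<inter> arc n k j \<noteq> {}" if "c \<in> \<phi> (v i)" "c \<in> \<phi> (v j)" for c i j
  proof -
    have "common p (v i) (v j)"
      using col true len that unfolding multicolouring_def ar by blast
    then show ?thesis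
      by (auto simp: common_def v_def)
  qed
  have "n * b = (\<Sum>i<n. b)" by simp
  also have "\<dots> \<le> (\<Sum>i<n. card (\<phi> (v i)))"
    using \<phi>(2) by (intro sum_mono)
  also have "\<dots> = (\<Sum>i<n. card {c \<in> {..<a}. c \<in> \<phi> (v i)})"
    using \<phi>(1) by (intro sum.cong refl arg_cong[where f = card]) auto
  also have "\<dots> = (\<Sum>c<a. card {i \<in> {..<n}. c \<in> \<phi> (v i)})"
    by (rule sum_multicount_gen) auto
  also have "\<dots> \<le> (\<Sum>c<a. k)"
    using meets by (intro sum_mono katona_circle[OF k]) auto
  finally show ?thesis by simp
qed

text \<open>For a rational \<open>n / k\<close> strictly between \<open>r\<close> and
  \<open>s\<close>, the threshold function with these parameters belongs to the clonoid of
  \<open>s\<close> but not to that of \<open>r\<close>; \<open>2 \<le> r\<close> ensures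
  \<open>2 * k \<le> n\<close>.\<close>

lemma inj_on_fractional_clonoid: "inj_on (fractional_clonoid p q) {2..}"
proof (rule linorder_inj_onI)
  fix r s :: real assume "r < s" "r \<in> {2..}"
  obtain z where z: "r < real_of_rat z" "real_of_rat z < s"
    using of_rat_dense[OF \<open>r < s\<close>] by blast
  obtain u w where uw: "z = Fract u w" "0 < w"
    by (cases z) auto
  have rz: "real_of_rat z = real_of_int u / real_of_int w"
    using uw by (simp add: of_rat_rat)
  have "0 < real_of_int u"
    using z rz uw \<open>r \<in> {2..}\<close> by (smt (verit) atLeast_iff divide_nonpos_pos of_int_0_less_iff)
  then have "0 < u" by simp
  define n k where "n = nat u" and "k = nat w"
  have nk: "real_of_int u = real n" "real_of_int w = real k" "0 < n" "0 < k"
    using uw \<open>0 < u\<close> by (auto simp: n_def k_def)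
  have less: "r * real k < real n" "real n \<le> s * real k"
    using z rz nk by (auto simp: field_simps)
  have "2 * real k \<le> r * real k"
    using \<open>r \<in> {2..}\<close> by (intro mult_right_mono) auto
  then have "2 * k \<le> n" using less by linarith
  have "threshold p q n k \<notin> fractional_clonoid p q r"
  proof
    assume "threshold p q n k \<in> fractional_clonoid p q r"
    then obtain a b \<phi> where ab: "0 < b" "real a \<le> r * real b"
        "multicolouring p q (threshold p q n k) a b \<phi>"
      by (auto simp: fractional_clonoid_def)
    have "n * b \<le> a * k"
      using multicolouring_threshold_ratio ab(3) nk(4) \<open>2 * k \<le> n\<close> by blast
    then have "real n * real b \<le> real a * real k"
      by (metis of_nat_le_iff of_nat_mult)
    also have "\<dots> \<le> r * real b * real k"
      using ab(2) by (intro mult_right_mono) auto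
    also have "\<dots> < real n * real b"
      using less(1) ab(1) by (simp add: mult.commute mult.left_commute)
    finally show False by simp
  qed
  then show "fractional_clonoid p q r \<noteq> fractional_clonoid p q s"
    using threshold_in_fractional_clonoid[OF nk(4,3) less(2)] by blast
qed auto

theorem theorem5p5:
  fixes C1 C2 :: "boolfun set"
  assumes "clone C1" and "clone C2"
    and "\<exists>K1\<in>{U 2, W 2}. C1 \<subseteq> K1"
    and "\<exists>K2\<in>{U \<infinity>, W \<infinity>}. C2 \<subseteq> K2"
  shows "uncountable {K. clonoid C1 C2 K}"
proof -
  have "C1 \<subseteq> boolfuns"
    using assms(1) by (simp add: clone_def)
  moreover obtain p where "\<And>g x y. g \<in> C1 \<Longrightarrow> length x = fst g \<Longrightarrow> length y = fst g \<Longrightarrow>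
      snd g x = p \<Longrightarrow> snd g y = p \<Longrightarrow> common p x y"
  proof (cases "C1 \<subseteq> U 2")
    case True
    then show ?thesis using that[of True] U_2_common by blast
  next
    case False
    then have "C1 \<subseteq> W 2" using assms(3) by blast
    then show ?thesis using that[of False] W_2_common by blast
  qed
  moreover obtain q where
    "\<And>h. h \<in> C2 \<Longrightarrow> \<exists>i<fst h. \<forall>x. length x = fst h \<longrightarrow> snd h x = q \<longrightarrow> x ! i = q"
  proof (cases "C2 \<subseteq> U \<infinity>")
    case True
    then show ?thesis using that[of True] U_infinity_le_proj by auto
  next
    case False
    then show ?thesis using that[of False] W_infinity_ge_proj assms(4) by auto
  qed
  \<comment> \<open>Any nondegenerate interval inside \<open>{2..}\<close> would do in place of
    \<open>{2..3}\<close>.\<close>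
  ultimately have "fractional_clonoid p q ` {2..3} \<subseteq> {K. clonoid C1 C2 K}"
    using clonoid_fractional_clonoid by blast
  moreover have "uncountable (fractional_clonoid p q ` {2..3})"
  proof
    assume "countable (fractional_clonoid p q ` {2..3})"
    moreover have "inj_on (fractional_clonoid p q) {2..3}"
      using inj_on_fractional_clonoid by (rule inj_on_subset) auto
    ultimately have "countable {2..3::real}"
      by (rule countable_image_inj_on)
    then show False
      using uncountable_closed_interval[of 2 "3::real"] by simp
  qed
  ultimately show ?thesis
    using countable_subset by blast
qed

end
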